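(* For every real $\alpha\geq -\frac14$, the function $$f_\alpha(x)=x^{\,x(\psi(x)-\log x)-\alpha}$$ is logarithmically completely monotonic on $(0,+\infty)$.
   Context: $\psi=\Gamma'/\Gamma$ is the digamma function on $(0,+\infty)$, where $\Gamma(x)=\int_0^\infty t^{x-1}e^{-t}\,dt$ is Euler's gamma function. A positive function $f$ is logarithmically completely monotonic on an open interval $I$ if it is infinitely differentiable on $I$ and $(-1)^n(\log f(x))^{(n)}\geq 0$ for all $x\in I$ and all integers $n\geq 1$. *)

theory Defs
  imports "HOL-Analysis.Analysis"
begin

(* On an open set the iterated derivatives at a point of I depend only on the values of f near
   that point, so the values of the total function f outside I are irrelevant. *)
definition log_completely_monotonic_on :: "(real \<Rightarrow> real) \<Rightarrow> real set \<Rightarrow> bool" where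
  "log_completely_monotonic_on f I \<longleftrightarrow>
     open I \<and> is_interval I \<and>
     (\<forall>x\<in>I. f x > 0) \<and>
     (\<forall>n. \<forall>x\<in>I. (deriv ^^ n) f differentiable (at x)) \<and>
     (\<forall>n\<ge>1. \<forall>x\<in>I. (-1) ^ n * (deriv ^^ n) (\<lambda>t. ln (f t)) x \<ge> 0)"

(* The library introduces Digamma by a series; on the positive reals it is Gamma' / Gamma. *)
lemma Digamma_eq_deriv_Gamma_quotient:
  fixes x :: real
  assumes "x > 0"
  shows "Digamma x = deriv Gamma x / Gamma x"
proof -
  have "x \<notin> \<int>\<^sub>\<le>\<^sub>0"
    using assms by (auto elim!: nonpos_Ints_cases)
  then have "deriv Gamma x = Gamma x * Digamma x"
    by (intro DERIV_imp_deriv has_field_derivative_Gamma)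
  with Gamma_real_pos[OF assms] show ?thesis
    by simp
qed

end

theory Submission
  imports Defs
begin

text \<open>
  Write \<open>ln f = (g - \<alpha>) ln x\<close> with \<open>g = x (\<psi> - ln x)\<close>, and let
  \<open>a\<^sub>k = (-1)\<^bsup>k+1\<^esup> x\<^bsup>k\<^esup> g\<^bsup>(k)\<^esup> / k!\<close>. Leibniz' rule gives
  \<open>(-1)\<^bsup>n\<^esup> x\<^bsup>n\<^esup> (ln f)\<^bsup>(n)\<^esup> / n! = (\<alpha> - g)/n + (\<Sum>k=1..<n. a\<^sub>k/(n-k)) - a\<^sub>n ln x\<close>.
  Here \<open>g \<le> -1/2\<close>, the \<open>a\<^sub>k\<close> are nonnegative and decrease from \<open>k = 2\<close> on, and \<open>a\<^sub>2 \<le> 1/(4x)\<close>.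
  Hence, for \<open>n \<ge> 2\<close>, the sum is at least \<open>a\<^sub>n H\<^bsub>n-2\<^esub> \<ge> a\<^sub>n ln (n-1)\<close>, and what remains,
  \<open>a\<^sub>n ln (x/(n-1)) \<le> 1/(8(n-1))\<close>, is absorbed by \<open>(\<alpha> - g)/n \<ge> 1/(4n)\<close>.
  For \<open>n = 1\<close> the bound \<open>0 \<le> a\<^sub>1 \<le> 1/(2x)\<close> suffices.

  For \<open>k \<ge> 2\<close>, positivity and monotonicity of \<open>a\<^sub>k\<close> say that the sums over \<open>m\<close> of \<open>m (x+m)\<^bsup>-k-1\<^esup>\<close> and
  \<open>m\<^sup>2 (x+m)\<^bsup>-k-2\<^esup>\<close> are at most the corresponding integrals. Both follow by summation by parts
  from lower bounds for the second and third differences of \<open>z\<^bsup>1-k\<^esup>\<close>.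
\<close>

subsection \<open>Differences of negative powers\<close>

text \<open>Binomial series with exponent \<open>-p\<close>. Its coefficients are nonnegative, so
  truncating such series or comparing them term by term yields the difference bounds below.\<close>

lemma inverse_power_series:
  fixes v :: real and p :: nat
  assumes "\<bar>v\<bar> < 1"
  shows "(\<lambda>j. pochhammer (real p) j / fact j * v ^ j) sums inverse ((1 - v) ^ p)"
proof -
  have "(\<lambda>j. (- real p gchoose j) * (- v) ^ j) sums (1 + (- v)) powr (- real p)"
    using assms by (intro gen_binomial_real) simp
  moreover have "(1 + (- v)) powr (- real p) = inverse ((1 - v) ^ p)"
    using assms by (simp add: powr_minus powr_realpow)
  moreover have "(- real p gchoose j) * (- v) ^ j = pochhammer (real p) j / fact j * v ^ j" for j
    by (simp add: gbinomial_pochhammer mult_ac flip: power_mult_distrib)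
  ultimately show ?thesis
    by simp
qed

text \<open>Adding the series at v and -v cancels the odd powers and leaves nonnegative even terms;
  the bound is the truncation after j = 2.\<close>

lemma second_difference_inverse_power_unit:
  fixes v :: real and p :: nat
  assumes "\<bar>v\<bar> < 1"
  shows "real p * (real p + 1) * v\<^sup>2
         \<le> inverse ((1 - v) ^ p) - 2 + inverse ((1 + v) ^ p)"
proof -
  let ?b = "\<lambda>j. pochhammer (real p) j / fact j"
  have s: "(\<lambda>j. ?b j * v ^ j + ?b j * (- v) ^ j) sums
           (inverse ((1 - v) ^ p) + inverse ((1 + v) ^ p))"
    using inverse_power_series[of v p] inverse_power_series[of "- v" p] assms
    by (intro sums_add) simp_all
  have nn: "0 \<le> ?b j * v ^ j + ?b j * (- v) ^ j" for j
    by (cases "even j") (auto simp: pochhammer_nonneg zero_le_even_power pochhammer_of_nat)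
  have "(\<Sum>j\<in>{..<3}. ?b j * v ^ j + ?b j * (- v) ^ j)
        \<le> inverse ((1 - v) ^ p) + inverse ((1 + v) ^ p)"
    using sum_le_suminf[OF sums_summable[OF s], of "{..<3}"] nn sums_unique[OF s] by simp
  moreover have "(\<Sum>j\<in>{..<3}. ?b j * v ^ j + ?b j * (- v) ^ j)
                 = 2 + real p * (real p + 1) * v\<^sup>2"
    by (simp add: eval_nat_numeral pochhammer_rec' algebra_simps)
  ultimately show ?thesis by simp
qed

text \<open>Rescaling by v = 1/z. In effect the second difference dominates the second derivative at
  the centre.\<close>

lemma second_difference_inverse_power:
  fixes z :: real and p :: nat
  assumes "z > 1"
  shows "real p * (real p + 1) * inverse (z ^ (p + 2))
         \<le> inverse ((z - 1) ^ p) - 2 * inverse (z ^ p) + inverse ((z + 1) ^ p)"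
proof -
  have e: "inverse ((1 - 1/z) ^ p) = z ^ p * inverse ((z - 1) ^ p)"
    "inverse ((1 + 1/z) ^ p) = z ^ p * inverse ((z + 1) ^ p)"
    using assms by (simp_all add: field_simps flip: power_mult_distrib)
  have "real p * (real p + 1) * (1/z)\<^sup>2
        \<le> z ^ p * inverse ((z - 1) ^ p) - 2 + z ^ p * inverse ((z + 1) ^ p)"
    using second_difference_inverse_power_unit[of "1/z" p] assms unfolding e by simp
  hence "inverse (z ^ p) * (real p * (real p + 1) * (1/z)\<^sup>2)
        \<le> inverse (z ^ p) * (z ^ p * inverse ((z - 1) ^ p) - 2 + z ^ p * inverse ((z + 1) ^ p))"
    using assms by (intro mult_left_mono) auto
  thus ?thesis
    using assms by (simp add: field_simps power_add power2_eq_square)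
qed

text \<open>Equality holds at j = 1, 3, 5 and the bound fails at j = 4, hence the parity. From 5 on
  induction runs over all j: the left side grows by the factor (j+1)/(j-2), which is at most
  3.\<close>

lemma cubic_le_power_three:
  fixes j :: nat
  assumes "odd j"
  shows "4 * (real j * (real j - 1) * (real j - 2)) \<le> 3 ^ j - 3"
proof -
  have *: "4 * (real j * (real j - 1) * (real j - 2)) \<le> 3 ^ j - 3" if "j \<ge> 5" for j :: nat
    using that
  proof (induction j rule: dec_induct)
    case (step j)
    have j: "real j \<ge> 5" using step by simp
    have "4 * ((real j + 1) * real j * (real j - 1)) = 4 * (real j * (real j - 1)) * (real j + 1)"
      by algebra
    also have "\<dots> \<le> 4 * (real j * (real j - 1)) * (3 * (real j - 2))"
      using j by (intro mult_left_mono) auto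
    finally show ?case using step by (simp add: algebra_simps)
  qed auto
  show ?thesis
  proof (cases "j \<ge> 5")
    case False
    hence "j = 1 \<or> j = 3" using assms by presburger
    thus ?thesis by auto
  qed (use * in auto)
qed

text \<open>
  Only odd powers of \<open>v\<close> survive in the difference below, so it reduces to comparing
  coefficients by \<open>cubic_le_power_three\<close>.
\<close>

lemma third_difference_inverse_power_unit:
  fixes v :: real and p :: nat
  assumes "0 < v" "v < 1/3"
  shows "4 * v ^ 3 * (real p * (real p + 1) * (real p + 2)) *
           (inverse ((1 - v) ^ (p + 3)) + inverse ((1 + v) ^ (p + 3)))
         \<le> inverse ((1 - 3 * v) ^ p) - 3 * inverse ((1 - v) ^ p)
           + 3 * inverse ((1 + v) ^ p) - inverse ((1 + 3 * v) ^ p)"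
proof -
  let ?b = "\<lambda>j. pochhammer (real p) j / fact j"
  let ?P = "real p * (real p + 1) * (real p + 2)"
  have l: "(\<lambda>j. ?b j * (3 * v) ^ j - 3 * (?b j * v ^ j) + 3 * (?b j * (- v) ^ j)
              - ?b j * (- 3 * v) ^ j) sums
        (inverse ((1 - 3 * v) ^ p) - 3 * inverse ((1 - v) ^ p)
           + 3 * inverse ((1 + v) ^ p) - inverse ((1 + 3 * v) ^ p))"
    using inverse_power_series[of "3 * v" p] inverse_power_series[of v p]
      inverse_power_series[of "- v" p] inverse_power_series[of "- 3 * v" p] assms
    by (intro sums_add sums_diff sums_mult) simp_all
  \<comment> \<open>The left-hand series with its index moved up by 3. The factor j(j-1)(j-2) kills
    the terms j = 0, 1, 2, so both series can be compared index by index.\<close>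
  let ?r = "\<lambda>j. 4 * (real j * (real j - 1) * (real j - 2)) * ?b j * (v ^ j - (- v) ^ j)"
  have shift: "?P * (pochhammer (real (p + 3)) j / fact j)
      = real (j + 3) * (real (j + 3) - 1) * (real (j + 3) - 2) * ?b (j + 3)" for j
  proof -
    define N where "N = real (j + 3) * (real (j + 3) - 1) * (real (j + 3) - 2)"
    have "pochhammer (real p) (j + 3) = ?P * pochhammer (real (p + 3)) j"
      by (simp add: eval_nat_numeral pochhammer_rec algebra_simps)
    moreover have "fact (j + 3) = N * fact j"
      by (simp add: N_def eval_nat_numeral algebra_simps)
    moreover have "N \<noteq> 0"
      by (simp add: N_def)
    ultimately show ?thesis
      unfolding N_def [symmetric] by simp
  qed
  have "(\<lambda>j. 4 * v ^ 3 * ?P * (pochhammer (real (p + 3)) j / fact j * v ^ j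
               + pochhammer (real (p + 3)) j / fact j * (- v) ^ j)) sums
     (4 * v ^ 3 * ?P * (inverse ((1 - v) ^ (p + 3)) + inverse ((1 + v) ^ (p + 3))))"
    using inverse_power_series[of v "p + 3"] inverse_power_series[of "- v" "p + 3"] assms
    by (intro sums_add sums_mult) simp_all
  also have "(\<lambda>j. 4 * v ^ 3 * ?P * (pochhammer (real (p + 3)) j / fact j * v ^ j
               + pochhammer (real (p + 3)) j / fact j * (- v) ^ j)) = (\<lambda>j. ?r (j + 3))"
  proof
    fix j
    have "4 * v ^ 3 * ?P * (pochhammer (real (p + 3)) j / fact j * v ^ j
               + pochhammer (real (p + 3)) j / fact j * (- v) ^ j)
        = 4 * (?P * (pochhammer (real (p + 3)) j / fact j)) * (v ^ 3 * (v ^ j + (- v) ^ j))"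
      by algebra
    also have "v ^ 3 * (v ^ j + (- v) ^ j) = v ^ (j + 3) - (- v) ^ (j + 3)"
      by (simp add: power_add algebra_simps)
    finally show "4 * v ^ 3 * ?P * (pochhammer (real (p + 3)) j / fact j * v ^ j
               + pochhammer (real (p + 3)) j / fact j * (- v) ^ j) = ?r (j + 3)"
      unfolding shift by (simp only: mult.assoc)
  qed
  finally have r: "?r sums
     (4 * v ^ 3 * ?P * (inverse ((1 - v) ^ (p + 3)) + inverse ((1 + v) ^ (p + 3))))"
    by (subst (asm) sums_zero_iff_shift) (auto simp: eval_nat_numeral less_Suc_eq)
  show ?thesis
  proof (rule sums_le[OF _ r l])
    fix j
    show "?r j \<le> ?b j * (3 * v) ^ j - 3 * (?b j * v ^ j) + 3 * (?b j * (- v) ^ j)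
              - ?b j * (- 3 * v) ^ j"
    proof (cases "even j")
      case False
      have "(2 * ?b j * v ^ j) * (4 * (real j * (real j - 1) * (real j - 2)))
            \<le> (2 * ?b j * v ^ j) * (3 ^ j - 3)"
        using assms cubic_le_power_three[OF False]
        by (intro mult_left_mono) (auto simp: pochhammer_nonneg pochhammer_of_nat)
      thus ?thesis using False by (simp add: power_mult_distrib algebra_simps diff_divide_distrib)
    qed (simp add: power_mult_distrib)
  qed
qed

text \<open>About the centre y = z + 3/2 the four nodes are y(1 - 3v), y(1 - v), y(1 + v), y(1 + 3v)
  with v = 1/(2y), and z > 0 gives v < 1/3. The left side averages minus the third derivative over
  the two inner nodes.\<close>

lemma third_difference_inverse_power:
  fixes z :: real and p :: nat
  assumes "z > 0"
  shows "real p * (real p + 1) * (real p + 2) / 2 *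
           (inverse ((z + 1) ^ (p + 3)) + inverse ((z + 2) ^ (p + 3)))
         \<le> inverse (z ^ p) - 3 * inverse ((z + 1) ^ p)
           + 3 * inverse ((z + 2) ^ p) - inverse ((z + 3) ^ p)"
proof -
  define y where "y = z + 3/2"
  define v where "v = 1 / (2 * y)"
  have y: "y > 3/2" using assms by (simp add: y_def)
  have v: "0 < v" "v < 1/3" using y by (auto simp: v_def field_simps)
  have yv: "y * v = 1/2" using y by (simp add: v_def)
  have z: "z = y * (1 - 3 * v)" "z + 1 = y * (1 - v)" "z + 2 = y * (1 + v)" "z + 3 = y * (1 + 3 * v)"
    by (simp_all only: ring_distribs mult.left_commute[of y 3] mult_1_right yv) (simp_all add: y_def)
  have y3: "inverse (y ^ (p + 3)) = inverse (y ^ p) * 8 * v ^ 3"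
    using y by (simp add: v_def power_add field_simps power3_eq_cube)
  let ?P = "real p * (real p + 1) * (real p + 2)"
  have "inverse (y ^ p) * (4 * v ^ 3 * ?P *
           (inverse ((1 - v) ^ (p + 3)) + inverse ((1 + v) ^ (p + 3))))
       \<le> inverse (y ^ p) * (inverse ((1 - 3 * v) ^ p) - 3 * inverse ((1 - v) ^ p)
           + 3 * inverse ((1 + v) ^ p) - inverse ((1 + 3 * v) ^ p))"
    using y by (intro mult_left_mono third_difference_inverse_power_unit v) auto
  moreover have "inverse (z ^ p) = inverse (y ^ p) * inverse ((1 - 3 * v) ^ p)"
    using z(1) by (metis power_mult_distrib inverse_mult_distrib)
  moreover have "inverse ((z + 1) ^ q) = inverse (y ^ q) * inverse ((1 - v) ^ q)"
    "inverse ((z + 2) ^ q) = inverse (y ^ q) * inverse ((1 + v) ^ q)"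
    "inverse ((z + 3) ^ q) = inverse (y ^ q) * inverse ((1 + 3 * v) ^ q)" for q
    unfolding z(2-4) by (simp_all only: power_mult_distrib inverse_mult_distrib)
  moreover have "?P / 2 * (inverse (y ^ p) * 8 * v ^ 3 * a + inverse (y ^ p) * 8 * v ^ 3 * b)
      = inverse (y ^ p) * (4 * v ^ 3 * ?P * (a + b))" for a b
    by algebra
  ultimately show ?thesis
    by (simp only: y3) (simp only: algebra_simps)
qed

subsection \<open>Hurwitz sums and the digamma function\<close>

definition hurwitz_sum :: "nat \<Rightarrow> real \<Rightarrow> real" where
  "hurwitz_sum s x = (\<Sum>m. inverse ((x + real m) ^ s))"

lemma hurwitz_sum_sums:
  assumes "x > 0" "s \<ge> 2"
  shows "(\<lambda>m. inverse ((x + real m) ^ s)) sums hurwitz_sum s x"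
  unfolding hurwitz_sum_def
  using Polygamma_converges'[of x s] assms by (intro summable_sums) auto

section \<open>Moments of Hurwitz sums and their comparison with integrals\<close>

lemma hurwitz_sum_first_moment:
  assumes "x > 0" "s \<ge> 2"
  shows "(\<lambda>m. real m * inverse ((x + real m) ^ Suc s)) sums
         (hurwitz_sum s x - x * hurwitz_sum (Suc s) x)"
proof -
  have "(\<lambda>m. inverse ((x + real m) ^ s) - x * inverse ((x + real m) ^ Suc s)) sums
         (hurwitz_sum s x - x * hurwitz_sum (Suc s) x)"
    using assms by (intro sums_diff sums_mult hurwitz_sum_sums) auto
  moreover have "inverse ((x + real m) ^ s) - x * inverse ((x + real m) ^ Suc s)
      = real m * inverse ((x + real m) ^ Suc s)" for m
  proof -
    have "x + real m \<noteq> 0" using assms by linarith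
    hence "inverse ((x + real m) ^ s) = (x + real m) * inverse ((x + real m) ^ Suc s)"
      by simp
    thus ?thesis by (simp only: ring_distribs)
  qed
  ultimately show ?thesis by simp
qed

lemma hurwitz_sum_second_moment:
  assumes "x > 0" "s \<ge> 2"
  shows "(\<lambda>m. (real m)\<^sup>2 * inverse ((x + real m) ^ (s + 2))) sums
         (hurwitz_sum s x - 2 * x * hurwitz_sum (s + 1) x + x\<^sup>2 * hurwitz_sum (s + 2) x)"
proof -
  have "(\<lambda>m. inverse ((x + real m) ^ s) - 2 * x * inverse ((x + real m) ^ (s + 1))
            + x\<^sup>2 * inverse ((x + real m) ^ (s + 2))) sums
         (hurwitz_sum s x - 2 * x * hurwitz_sum (s + 1) x + x\<^sup>2 * hurwitz_sum (s + 2) x)"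
    using assms by (intro sums_diff sums_add sums_mult hurwitz_sum_sums) auto
  moreover have "inverse ((x + real m) ^ s) - 2 * x * inverse ((x + real m) ^ (s + 1))
            + x\<^sup>2 * inverse ((x + real m) ^ (s + 2))
      = (real m)\<^sup>2 * inverse ((x + real m) ^ (s + 2))" for m
  proof -
    have nz: "x + real m \<noteq> 0" using assms by linarith
    have "inverse ((x + real m) ^ s) = (x + real m)\<^sup>2 * inverse ((x + real m) ^ (s + 2))"
      "inverse ((x + real m) ^ (s + 1)) = (x + real m) * inverse ((x + real m) ^ (s + 2))"
      using nz by (simp_all add: power_add power2_eq_square divide_simps)
    thus ?thesis by algebra
  qed
  ultimately show ?thesis by simp
qed

text \<open>The right side is p(p+1) times the integral of t (x+t)^(-p-2) over t >= 0. Each term is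
  bounded by m times a second difference of (x+m)^(-p), and these telescope.\<close>

lemma hurwitz_sum_first_moment_le:
  assumes "x > 0" "p \<ge> 1"
  shows "real p * (real p + 1) * (hurwitz_sum (p + 1) x - x * hurwitz_sum (p + 2) x)
         \<le> inverse (x ^ p)"
proof -
  let ?C = "\<lambda>m. inverse ((x + real m) ^ p)"
  let ?c = "\<lambda>m. real p * (real p + 1) * (real m * inverse ((x + real m) ^ (p + 2)))"
  \<comment> \<open>The m = 0 term vanishes, so second differences are only taken at x + m > 1. The
    boundary terms at M are together nonpositive because \<open>?C\<close> decreases.\<close>
  have partial: "(\<Sum>m<Suc M. ?c m) \<le> ?C 0 - (real M + 1) * ?C M + real M * ?C (Suc M)" for M
  proof (induction M)
    case (Suc M)
    have d: "real p * (real p + 1) * inverse ((x + real (Suc M)) ^ (p + 2))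
          \<le> ?C M - 2 * ?C (Suc M) + ?C (Suc (Suc M))"
      using second_difference_inverse_power[of "x + real (Suc M)" p] assms
      by (simp add: algebra_simps)
    have "?c (Suc M) \<le> real (Suc M) * (?C M - 2 * ?C (Suc M) + ?C (Suc (Suc M)))"
      using mult_left_mono[OF d, of "real (Suc M)"] by (simp add: mult.left_commute)
    moreover have "(\<Sum>m<Suc (Suc M). ?c m) = (\<Sum>m<Suc M. ?c m) + ?c (Suc M)"
      by simp
    ultimately show ?case
      using Suc.IH by (simp add: algebra_simps)
  qed simp
  have "?c sums (real p * (real p + 1) * (hurwitz_sum (p + 1) x - x * hurwitz_sum (p + 2) x))"
    using hurwitz_sum_first_moment[of x "p + 1"] assms by (intro sums_mult) simp
  hence lim: "(\<lambda>M. \<Sum>m<Suc M. ?c m) \<longlonglongrightarrow>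
      real p * (real p + 1) * (hurwitz_sum (p + 1) x - x * hurwitz_sum (p + 2) x)"
    unfolding sums_def by (rule LIMSEQ_Suc)
  have le: "(\<Sum>m<Suc M. ?c m) \<le> inverse (x ^ p)" for M
  proof -
    have "?C (Suc M) \<le> ?C M"
      using assms by (intro le_imp_inverse_le power_mono) auto
    hence "real M * ?C (Suc M) \<le> (real M + 1) * ?C M"
      using assms by (intro mult_mono) auto
    thus ?thesis using partial[of M] by simp
  qed
  show ?thesis
    by (rule LIMSEQ_le_const2[OF lim]) (use le in auto)
qed

text \<open>The right side is p(p+1)(p+2) times the integral of t^2 (x+t)^(-p-3) over t >= 0. A
  third difference controls two neighbouring terms at once, so the weight m^2 is split into two
  consecutive triangular numbers.\<close>

lemma hurwitz_sum_second_moment_le: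
  assumes "x > 0" "p \<ge> 1"
  shows "real p * (real p + 1) * (real p + 2) *
           (hurwitz_sum (p + 1) x - 2 * x * hurwitz_sum (p + 2) x + x\<^sup>2 * hurwitz_sum (p + 3) x)
         \<le> 2 * inverse (x ^ p)"
proof -
  let ?K = "real p * (real p + 1) * (real p + 2)"
  let ?C = "\<lambda>m. inverse ((x + real m) ^ p)"
  let ?c = "\<lambda>m. inverse ((x + real m) ^ (p + 3))"
  \<comment> \<open>\<open>R M\<close> is the remainder when \<open>(j+1)(j+2)\<close> times the third difference of \<open>C\<close> at \<open>j\<close>
    is summed over \<open>j < M\<close>; the weights \<open>t\<close> satisfy \<open>t M + t (M+1) = (M+1)\<^sup>2\<close>.\<close>
  define t :: "nat \<Rightarrow> real" where "t = (\<lambda>M. real M * (real M + 1) / 2)"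
  define R where "R = (\<lambda>M. (real M + 1) * (real M + 2) * ?C M
       - 2 * real M * (real M + 2) * ?C (M + 1) + real M * (real M + 1) * ?C (M + 2))"
  have t0: "t M \<ge> 0" for M by (simp add: t_def)
  have t: "t M + t (Suc M) = (real (Suc M))\<^sup>2" for M
    by (simp add: t_def power2_eq_square field_simps)
  \<comment> \<open>The summand with \<open>?c (Suc M)\<close> is the half of the next term that the
    differences used so far already cover.\<close>
  have partial: "(\<Sum>m<Suc M. ?K * ((real m)\<^sup>2 * ?c m)) + ?K * t M * ?c (Suc M)
      \<le> 2 * ?C 0 - R M" for M
  proof (induction M)
    case 0
    show ?case by (simp add: t_def R_def)
  next
    case (Suc M)
    have d: "?K / 2 * (?c (M + 1) + ?c (M + 2))
          \<le> ?C M - 3 * ?C (M + 1) + 3 * ?C (M + 2) - ?C (M + 3)"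
      using third_difference_inverse_power[of "x + real M" p] assms
      by (simp add: add_ac)
    have "?K * t (Suc M) * (?c (M + 1) + ?c (M + 2))
        = 2 * t (Suc M) * (?K / 2 * (?c (M + 1) + ?c (M + 2)))"
      by algebra
    also have "\<dots> \<le> 2 * t (Suc M) * (?C M - 3 * ?C (M + 1) + 3 * ?C (M + 2) - ?C (M + 3))"
      using d t0[of "Suc M"] by (intro mult_left_mono) auto
    also have "\<dots> = R M - R (Suc M)"
    proof -
      have "R (Suc M) = (real M + 2) * (real M + 3) * ?C (M + 1)
          - 2 * (real M + 1) * (real M + 3) * ?C (M + 2) + (real M + 1) * (real M + 2) * ?C (M + 3)"
        by (simp add: R_def numeral_eq_Suc add_ac)
      moreover have "2 * t (Suc M) = (real M + 1) * (real M + 2)"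
        by (simp add: t_def algebra_simps)
      ultimately show ?thesis
        unfolding R_def by algebra
    qed
    finally have "?K * t (Suc M) * (?c (M + 1) + ?c (M + 2)) \<le> R M - R (Suc M)" .
    moreover have "(\<Sum>m<Suc (Suc M). ?K * ((real m)\<^sup>2 * ?c m))
        = (\<Sum>m<Suc M. ?K * ((real m)\<^sup>2 * ?c m)) + ?K * ((t M + t (Suc M)) * ?c (Suc M))"
      by (simp add: t)
    ultimately show ?case
      using Suc.IH by (simp add: algebra_simps)
  qed
  have "(\<lambda>m. ?K * ((real m)\<^sup>2 * ?c m)) sums
      (?K * (hurwitz_sum (p + 1) x - 2 * x * hurwitz_sum (p + 2) x + x\<^sup>2 * hurwitz_sum (p + 3) x))"
    using hurwitz_sum_second_moment[of x "p + 1"] assms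
    by (intro sums_mult) (simp add: numeral_eq_Suc)
  hence lim: "(\<lambda>M. \<Sum>m<Suc M. ?K * ((real m)\<^sup>2 * ?c m)) \<longlonglongrightarrow>
      ?K * (hurwitz_sum (p + 1) x - 2 * x * hurwitz_sum (p + 2) x + x\<^sup>2 * hurwitz_sum (p + 3) x)"
    unfolding sums_def by (rule LIMSEQ_Suc)
  have le: "(\<Sum>m<Suc M. ?K * ((real m)\<^sup>2 * ?c m)) \<le> 2 * inverse (x ^ p)" for M
  proof -
    have "0 \<le> real p * (real p + 1) * inverse ((x + real M + 1) ^ (p + 2))"
      using assms by simp
    also have "\<dots> \<le> ?C M - 2 * ?C (M + 1) + ?C (M + 2)"
      using second_difference_inverse_power[of "x + real M + 1" p] assms
      by (simp add: add_ac)
    finally have conv: "0 \<le> ?C M - 2 * ?C (M + 1) + ?C (M + 2)" .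
    have "?C (M + 1) \<le> ?C M"
      using assms by (intro le_imp_inverse_le power_mono) auto
    hence dec: "real M * ?C (M + 1) \<le> (real M + 1) * ?C M"
      using assms by (intro mult_mono) auto
    \<comment> \<open>Nonnegativity of the remainder comes from convexity and decrease of
      \<open>?C\<close>.\<close>
    have "R M = real M * (real M + 1) * (?C M - 2 * ?C (M + 1) + ?C (M + 2))
        + 2 * ((real M + 1) * ?C M - real M * ?C (M + 1))"
      unfolding R_def by algebra
    also have "\<dots> \<ge> 0"
      using conv dec by (intro add_nonneg_nonneg [OF mult_nonneg_nonneg mult_nonneg_nonneg]) auto
    finally have "R M \<ge> 0" .
    moreover have "0 \<le> ?K * t M * ?c (Suc M)"
      using assms t0[of M] by (intro mult_nonneg_nonneg) auto
    ultimately show ?thesis using partial[of M] by simp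
  qed
  show ?thesis
    by (rule LIMSEQ_le_const2[OF lim]) (use le in auto)
qed

section \<open>Explicit bounds by telescoping\<close>

lemma tendsto_inverse_add_real:
  "(\<lambda>m. inverse (x + real m)) \<longlonglongrightarrow> 0"
  by (intro tendsto_inverse_0_at_top filterlim_tendsto_add_at_top[OF tendsto_const]
      filterlim_real_sequentially)

text \<open>\<open>V\<close> is a truncated asymptotic expansion of the sum with its last
  coefficient raised from 1/6 to 1/2, which makes each term at most V z - V (z+1). The next two
  bounds use plain truncations.\<close>

lemma hurwitz_sum_2_le:
  assumes "x > 0"
  shows "hurwitz_sum 2 x \<le> 1 / x + 1 / (2 * x\<^sup>2) + 1 / (2 * x ^ 3)"
proof -
  define V where "V = (\<lambda>z::real. inverse z + inverse z ^ 2 / 2 + inverse z ^ 3 / 2)"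
  have V: "(\<lambda>m. V (x + real m)) \<longlonglongrightarrow> 0"
    unfolding V_def
    by (intro tendsto_add_zero tendsto_divide_zero tendsto_null_power tendsto_inverse_add_real) auto
  have step: "inverse (z\<^sup>2) \<le> V z - V (z + 1)" if "z > 0" for z
  proof -
    have "V z - V (z + 1) - inverse (z\<^sup>2) = (2 * z\<^sup>2 + 2 * z + 1) / (2 * z ^ 3 * (z + 1) ^ 3)"
      using that by (simp add: V_def divide_simps) algebra
    also have "\<dots> \<ge> 0" using that by simp
    finally show ?thesis by simp
  qed
  have "hurwitz_sum 2 x \<le> V (x + real 0) - 0"
    using assms step[of "x + real _"]
    by (intro sums_le[OF _ hurwitz_sum_sums telescope_sums'[OF V]]) (auto simp: add_ac)
  thus ?thesis by (simp add: V_def field_simps)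
qed

lemma hurwitz_sum_2_ge:
  assumes "x > 0"
  shows "hurwitz_sum 2 x \<ge> 1 / x + 1 / (2 * x\<^sup>2)"
proof -
  define V where "V = (\<lambda>z::real. inverse z + inverse z ^ 2 / 2)"
  have V: "(\<lambda>m. V (x + real m)) \<longlonglongrightarrow> 0"
    unfolding V_def
    by (intro tendsto_add_zero tendsto_divide_zero tendsto_null_power tendsto_inverse_add_real) auto
  have step: "V z - V (z + 1) \<le> inverse (z\<^sup>2)" if "z > 0" for z
  proof -
    have "inverse (z\<^sup>2) - (V z - V (z + 1)) = 1 / (2 * z\<^sup>2 * (z + 1)\<^sup>2)"
      using that by (simp add: V_def divide_simps) algebra
    also have "\<dots> \<ge> 0" using that by simp
    finally show ?thesis by simp
  qed
  have "V (x + real 0) - 0 \<le> hurwitz_sum 2 x"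
    using assms step[of "x + real _"]
    by (intro sums_le[OF _ telescope_sums'[OF V] hurwitz_sum_sums]) (auto simp: add_ac)
  thus ?thesis by (simp add: V_def field_simps)
qed

lemma hurwitz_sum_3_le:
  assumes "x > 0"
  shows "hurwitz_sum 3 x \<le> 1 / (2 * x\<^sup>2) + 1 / (2 * x ^ 3) + 1 / (4 * x ^ 4)"
proof -
  define V where "V = (\<lambda>z::real. inverse z ^ 2 / 2 + inverse z ^ 3 / 2 + inverse z ^ 4 / 4)"
  have V: "(\<lambda>m. V (x + real m)) \<longlonglongrightarrow> 0"
    unfolding V_def
    by (intro tendsto_add_zero tendsto_divide_zero tendsto_null_power tendsto_inverse_add_real) auto
  have step: "inverse (z ^ 3) \<le> V z - V (z + 1)" if "z > 0" for z
  proof -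
    have "V z - V (z + 1) - inverse (z ^ 3) = (2 * z + 1) / (4 * z ^ 4 * (z + 1) ^ 4)"
      using that by (simp add: V_def divide_simps) algebra
    also have "\<dots> \<ge> 0" using that by simp
    finally show ?thesis by simp
  qed
  have "hurwitz_sum 3 x \<le> V (x + real 0) - 0"
    using assms step[of "x + real _"]
    by (intro sums_le[OF _ hurwitz_sum_sums telescope_sums'[OF V]]) (auto simp: add_ac)
  thus ?thesis by (simp add: V_def field_simps)
qed

text \<open>The difference is the series over z = x + n of 1/z - ln((z+1)/z). By the trapezoid bound
  and ln((z+1)/z) >= 1/(z+1), each term lies between one half and the whole of 1/z - 1/(z+1), which
  telescopes to 1/x.\<close>

lemma ln_minus_Digamma_bounds:
  fixes x :: real
  assumes "x > 0"
  shows "1 / (2 * x) \<le> ln x - Digamma x" "ln x - Digamma x \<le> 1 / x"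
proof -
  have step: "inverse z - inverse (z + 1) \<le> 2 * (inverse z - (ln (z + 1) - ln z))"
    "inverse z - (ln (z + 1) - ln z) \<le> inverse z - inverse (z + 1)" if "z > 0" for z :: real
  proof -
    show "inverse z - inverse (z + 1) \<le> 2 * (inverse z - (ln (z + 1) - ln z))"
      using ln_inverse_approx_le[of z 1] that by simp
    have "inverse (z + 1) \<le> 2 * (z + 1 - z) / (z + (z + 1))"
      using that by (simp add: field_simps)
    also have "\<dots> \<le> ln (z + 1) - ln z"
      using that by (intro ln_inverse_approx_ge) auto
    finally show "inverse z - (ln (z + 1) - ln z) \<le> inverse z - inverse (z + 1)"
      by simp
  qed
  let ?S = "\<lambda>m. (\<Sum>n<m. inverse (x + real n)) - (ln (x + real m) - ln x)"
  have S: "?S m = (\<Sum>n<m. inverse (x + real n) - (ln (x + real n + 1) - ln (x + real n)))" for m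
    by (induction m) (auto simp: add_ac)
  have T: "inverse x - inverse (x + real m) = (\<Sum>n<m. inverse (x + real n) - inverse (x + real n + 1))" for m
    by (induction m) (auto simp: add_ac)
  have lo: "inverse x - inverse (x + real m) \<le> 2 * ?S m" for m
    unfolding S T sum_distrib_left using assms by (intro sum_mono step) simp
  have hi: "?S m \<le> inverse x - inverse (x + real m)" for m
    unfolding S T using assms by (intro sum_mono step) simp
  have lim: "(\<lambda>m. inverse x - inverse (x + real m)) \<longlonglongrightarrow> inverse x"
    using tendsto_diff[OF tendsto_const[of "inverse x"] tendsto_inverse_add_real[of x]] by simp
  \<comment> \<open>The known limit for \<open>Digamma\<close> contains ln m, the telescoped sum ln
    (x+m); they differ by ln (1 + x/m), which tends to 0.\<close>
  have Slim: "?S \<longlonglongrightarrow> ln x - Digamma x"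
  proof -
    have r: "(\<lambda>m. 1 + x * inverse (0 + real m)) \<longlonglongrightarrow> 1"
      using tendsto_add[OF tendsto_const[of 1]
          tendsto_mult[OF tendsto_const[of x] tendsto_inverse_add_real[of 0]]] by simp
    have l: "(\<lambda>m. ln x - (ln (real m) - (\<Sum>n<m. inverse (x + real n)))
              - ln (1 + x * inverse (0 + real m))) \<longlonglongrightarrow> ln x - Digamma x - ln 1"
      using Digamma_LIMSEQ[of x] assms by (intro tendsto_intros tendsto_ln r) auto
    have e: "\<forall>\<^sub>F m in sequentially. ln x - (ln (real m) - (\<Sum>n<m. inverse (x + real n)))
              - ln (1 + x * inverse (0 + real m)) = ?S m"
      using eventually_gt_at_top[of 0]
    proof eventually_elim
      case (elim m)
      have "x + real m = real m * (1 + x * inverse (0 + real m))"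
        using elim by (simp add: field_simps)
      hence "ln (x + real m) = ln (real m * (1 + x * inverse (0 + real m)))"
        by (simp only:)
      also have "\<dots> = ln (real m) + ln (1 + x * inverse (0 + real m))"
        using elim assms by (intro ln_mult_pos) (auto intro!: add_pos_nonneg)
      finally show ?case by simp
    qed
    show ?thesis using Lim_transform_eventually[OF l e] by simp
  qed
  have "ln x - Digamma x \<le> inverse x"
    by (rule LIMSEQ_le[OF Slim lim]) (use hi in blast)
  thus "ln x - Digamma x \<le> 1 / x"
    by (simp add: inverse_eq_divide)
  have "inverse x \<le> 2 * (ln x - Digamma x)"
    by (rule LIMSEQ_le[OF lim tendsto_mult[OF tendsto_const Slim]]) (use lo in blast)
  thus "1 / (2 * x) \<le> ln x - Digamma x"
    by (simp add: inverse_eq_divide)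
qed

subsection \<open>Derivatives of the exponent\<close>

definition ln_deriv :: "nat \<Rightarrow> real \<Rightarrow> real" where
  "ln_deriv n x = (case n of 0 \<Rightarrow> ln x | Suc j \<Rightarrow> (- 1) ^ j * fact j / x ^ Suc j)"

lemma ln_deriv_simps [simp]:
  "ln_deriv 0 x = ln x"
  "ln_deriv (Suc j) x = (- 1) ^ j * fact j / x ^ Suc j"
  by (simp_all add: ln_deriv_def)

lemma has_field_derivative_ln_deriv:
  assumes "x > 0"
  shows "(ln_deriv n has_real_derivative ln_deriv (Suc n) x) (at x)"
proof (cases n)
  case 0
  have "ln_deriv 0 = ln" by auto
  thus ?thesis using 0 assms by (auto intro!: derivative_eq_intros simp: divide_simps)
next
  case (Suc j)
  have "((\<lambda>x. (- 1) ^ j * fact j * inverse (x ^ Suc j)) has_real_derivative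
          (- 1) ^ j * fact j * (- (real (Suc j) * x ^ j) / (x ^ Suc j)\<^sup>2)) (at x)"
    using assms by (auto intro!: derivative_eq_intros simp: power2_eq_square divide_simps simp del: power_Suc)
  moreover have "ln_deriv n = (\<lambda>x. (- 1) ^ j * fact j * inverse (x ^ Suc j))"
    by (auto simp: Suc divide_inverse)
  moreover have "ln_deriv (Suc n) x = (- 1) ^ j * fact j * (- (real (Suc j) * x ^ j) / (x ^ Suc j)\<^sup>2)"
    using assms by (simp add: Suc field_simps power2_eq_square)
  ultimately show ?thesis by simp
qed

text \<open>Leibniz' rule for the product of x and \<open>Digamma x - ln x\<close>. At k = 0 the
  truncated index k - 1 is harmless, since the factor k is 0.\<close>

definition exponent_deriv :: "nat \<Rightarrow> real \<Rightarrow> real" where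
  "exponent_deriv k x = x * (Polygamma k x - ln_deriv k x)
     + real k * (Polygamma (k - 1) x - ln_deriv (k - 1) x)"

lemma exponent_deriv_0: "exponent_deriv 0 x = x * (Digamma x - ln x)"
  by (simp add: exponent_deriv_def)

lemma has_field_derivative_exponent_deriv:
  assumes "x > 0"
  shows "(exponent_deriv k has_real_derivative exponent_deriv (Suc k) x) (at x)"
proof -
  have x: "x \<notin> \<int>\<^sub>\<le>\<^sub>0"
    using assms by (auto elim!: nonpos_Ints_cases)
  have q: "((\<lambda>x. Polygamma j x - ln_deriv j x) has_real_derivative
            Polygamma (Suc j) x - ln_deriv (Suc j) x) (at x)" for j
    using x assms by (intro DERIV_diff has_field_derivative_Polygamma has_field_derivative_ln_deriv)
  have "((\<lambda>x. x * (Polygamma k x - ln_deriv k x)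
     + real k * (Polygamma (k - 1) x - ln_deriv (k - 1) x)) has_real_derivative
      (1 * (Polygamma k x - ln_deriv k x) + (Polygamma (Suc k) x - ln_deriv (Suc k) x) * x)
     + real k * (Polygamma (Suc (k - 1)) x - ln_deriv (Suc (k - 1)) x)) (at x)"
    by (intro DERIV_add DERIV_mult DERIV_cmult DERIV_ident q)
  moreover have "(1 * (Polygamma k x - ln_deriv k x) + (Polygamma (Suc k) x - ln_deriv (Suc k) x) * x)
     + real k * (Polygamma (Suc (k - 1)) x - ln_deriv (Suc (k - 1)) x) = exponent_deriv (Suc k) x"
    by (cases k) (simp_all add: exponent_deriv_def algebra_simps del: ln_deriv_simps)
  ultimately show ?thesis
    unfolding exponent_deriv_def [abs_def] by (simp only:)
qed

text \<open>With \<open>exponent_deriv k\<close> the \<open>k\<close>-th derivative of \<open>g\<close>, this is \<open>a\<^sub>k\<close> above.\<close>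

definition taylor_coeff :: "nat \<Rightarrow> real \<Rightarrow> real" where
  "taylor_coeff k x = (- 1) ^ Suc k * x ^ k / fact k * exponent_deriv k x"

lemma exponent_deriv_eq:
  assumes "x > 0"
  shows "exponent_deriv k x = (- 1) ^ Suc k * fact k / x ^ k * taylor_coeff k x"
  using assms by (simp add: taylor_coeff_def)

lemma Polygamma_eq_hurwitz_sum:
  "n \<ge> 1 \<Longrightarrow> Polygamma n x = (- 1) ^ Suc n * fact n * hurwitz_sum (Suc n) x"
  by (simp add: Polygamma_def hurwitz_sum_def)

text \<open>This exhibits the coefficient as x^(p+1) times the integral of t (x+t)^(-p-2) minus the
  corresponding sum, the form to which the first moment bound applies.\<close>

lemma taylor_coeff_eq:
  assumes "x > 0" "p \<ge> 1"
  shows "taylor_coeff (p + 1) x = x / (real p * (real p + 1))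
           - x ^ (p + 1) * (hurwitz_sum (p + 1) x - x * hurwitz_sum (p + 2) x)"
proof -
  obtain j where p: "p = Suc j" using assms by (cases p) auto
  have "exponent_deriv (p + 1) x = (- 1) ^ p *
      (x * (fact (p + 1) * hurwitz_sum (p + 2) x - fact p / x ^ (p + 1))
       - (real p + 1) * (fact p * hurwitz_sum (p + 1) x - fact j / x ^ p))"
    using assms by (simp add: exponent_deriv_def Polygamma_eq_hurwitz_sum p algebra_simps)
      (simp flip: add_divide_distrib)
  also have "x * (fact (p + 1) * hurwitz_sum (p + 2) x - fact p / x ^ (p + 1))
       - (real p + 1) * (fact p * hurwitz_sum (p + 1) x - fact j / x ^ p)
     = fact (p + 1) * (x * hurwitz_sum (p + 2) x - hurwitz_sum (p + 1) x
         + inverse (x ^ p) / (real p * (real p + 1)))"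
  proof -
    have f: "fact p = real p * (fact j :: real)"
      "fact (p + 1) = (real p + 1) * (real p * (fact j :: real))"
      by (simp_all add: p algebra_simps)
    have "(real p + 1) * (real p * fact j) * (inverse (x ^ p) / (real p * (real p + 1)))
        = fact j * inverse (x ^ p)"
      using assms by simp
    moreover have "x * (real p * fact j / x ^ (p + 1)) = real p * fact j * inverse (x ^ p)"
      using assms by (simp add: divide_inverse)
    moreover have "fact j / x ^ p = fact j * inverse (x ^ p)"
      by (simp add: divide_inverse)
    ultimately show ?thesis
      unfolding f by algebra
  qed
  finally have "taylor_coeff (p + 1) x = x ^ (p + 1) * (x * hurwitz_sum (p + 2) x - hurwitz_sum (p + 1) x
         + inverse (x ^ p) / (real p * (real p + 1)))"
    by (simp add: taylor_coeff_def del: fact_Suc)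
  also have "\<dots> = x / (real p * (real p + 1))
           - x ^ (p + 1) * (hurwitz_sum (p + 1) x - x * hurwitz_sum (p + 2) x)"
    using assms by (simp add: algebra_simps)
  finally show ?thesis .
qed

lemma taylor_coeff_nonneg_ge_2:
  assumes "x > 0" "k \<ge> 2"
  shows "taylor_coeff k x \<ge> 0"
proof -
  define p where "p = k - 1"
  have p: "p \<ge> 1" "k = p + 1" using assms by (auto simp: p_def)
  have "x ^ (p + 1) * (real p * (real p + 1) * (hurwitz_sum (p + 1) x - x * hurwitz_sum (p + 2) x))
        \<le> x ^ (p + 1) * inverse (x ^ p)"
    using assms p by (intro mult_left_mono hurwitz_sum_first_moment_le) auto
  also have "\<dots> = x" using assms by simp
  finally have "(real p * (real p + 1)) * (x ^ (p + 1) * (hurwitz_sum (p + 1) x - x * hurwitz_sum (p + 2) x)) \<le> x"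
    by (simp only: mult_ac)
  hence "x ^ (p + 1) * (hurwitz_sum (p + 1) x - x * hurwitz_sum (p + 2) x) \<le> x / (real p * (real p + 1))"
    using p by (simp add: pos_le_divide_eq mult_ac del: power_Suc)
  thus ?thesis
    unfolding p(2) taylor_coeff_eq[OF assms(1) p(1)] by (rule diff_ge_0_iff_ge [THEN iffD2])
qed

text \<open>Since t (x+t)^(-k-1) - x t (x+t)^(-k-2) = t^2 (x+t)^(-k-2), the difference of
  consecutive coefficients is again an integral minus a sum, now of second moments.\<close>

lemma taylor_coeff_Suc_le:
  assumes "x > 0" "k \<ge> 2"
  shows "taylor_coeff (Suc k) x \<le> taylor_coeff k x"
proof -
  define p where "p = k - 1"
  have p: "p \<ge> 1" "k = p + 1" using assms by (auto simp: p_def)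
  let ?K = "real p * (real p + 1) * (real p + 2)"
  let ?M = "hurwitz_sum (p + 1) x - 2 * x * hurwitz_sum (p + 2) x + x\<^sup>2 * hurwitz_sum (p + 3) x"
  have "x ^ (p + 1) * (?K * ?M) \<le> x ^ (p + 1) * (2 * inverse (x ^ p))"
    using assms p by (intro mult_left_mono hurwitz_sum_second_moment_le) auto
  also have "\<dots> = 2 * x" using assms by simp
  finally have "?K * (x ^ (p + 1) * ?M) \<le> 2 * x"
    by (simp only: mult_ac)
  hence "x ^ (p + 1) * ?M \<le> 2 * x / ?K"
    using p by (simp add: pos_le_divide_eq mult_ac del: power_Suc)
  also have "2 * x / ?K = x / (real p * (real p + 1)) - x / ((real p + 1) * (real p + 2))"
    using p by (simp add: divide_simps) (simp add: algebra_simps)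
  also have "x ^ (p + 1) * ?M = x ^ (p + 1) * (hurwitz_sum (p + 1) x - x * hurwitz_sum (p + 2) x)
      - x ^ (p + 2) * (hurwitz_sum (p + 2) x - x * hurwitz_sum (p + 3) x)"
    by (simp add: algebra_simps power2_eq_square)
  finally show ?thesis
    using taylor_coeff_eq[of x p] taylor_coeff_eq[of x "p + 1"] p assms
    by (simp add: numeral_eq_Suc add_ac del: power_Suc)
qed

lemma taylor_coeff_antimono:
  assumes "x > 0" "2 \<le> k" "k \<le> n"
  shows "taylor_coeff n x \<le> taylor_coeff k x"
  using assms(3)
proof (induction n rule: dec_induct)
  case (step n)
  thus ?case using taylor_coeff_Suc_le[of x n] assms by simp
qed simp

text \<open>After inserting the expansions all terms down to the constant cancel, leaving exactly
  1/(4x).\<close>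

lemma taylor_coeff_2_le:
  assumes "x > 0"
  shows "taylor_coeff 2 x \<le> 1 / (4 * x)"
proof -
  have "x\<^sup>2 * (1 / x + 1 / (2 * x\<^sup>2)) \<le> x\<^sup>2 * hurwitz_sum 2 x"
    using assms by (intro mult_left_mono hurwitz_sum_2_ge) auto
  moreover have "x ^ 3 * hurwitz_sum 3 x \<le> x ^ 3 * (1 / (2 * x\<^sup>2) + 1 / (2 * x ^ 3) + 1 / (4 * x ^ 4))"
    using assms by (intro mult_left_mono hurwitz_sum_3_le) auto
  moreover have "x\<^sup>2 * (1 / x + 1 / (2 * x\<^sup>2)) = x + 1 / 2"
    "x ^ 3 * (1 / (2 * x\<^sup>2) + 1 / (2 * x ^ 3) + 1 / (4 * x ^ 4)) = x / 2 + 1 / 2 + 1 / (4 * x)"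
    using assms by (simp_all add: field_simps power2_eq_square power3_eq_cube power4_eq_xxxx)
  moreover have "taylor_coeff 2 x = x / 2 - x\<^sup>2 * hurwitz_sum 2 x + x ^ 3 * hurwitz_sum 3 x"
    using taylor_coeff_eq[of x 1] assms
    by (simp add: numeral_eq_Suc algebra_simps)
  ultimately show ?thesis by simp
qed

lemma exponent_deriv_1:
  assumes "x > 0"
  shows "exponent_deriv 1 x = x * hurwitz_sum 2 x - 1 - (ln x - Digamma x)"
  using assms Polygamma_eq_hurwitz_sum[of 1 x]
  by (simp add: exponent_deriv_def numeral_eq_Suc algebra_simps)

lemma taylor_coeff_1_le:
  assumes "x > 0"
  shows "taylor_coeff 1 x \<le> 1 / (2 * x)"
proof -
  have "x\<^sup>2 * hurwitz_sum 2 x \<le> x\<^sup>2 * (1 / x + 1 / (2 * x\<^sup>2) + 1 / (2 * x ^ 3))"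
    using assms by (intro mult_left_mono hurwitz_sum_2_le) auto
  also have "\<dots> = x + 1 / 2 + 1 / (2 * x)"
    using assms by (simp add: field_simps power2_eq_square power3_eq_cube)
  finally have "x\<^sup>2 * hurwitz_sum 2 x \<le> x + 1 / 2 + 1 / (2 * x)" .
  moreover have "x * (1 / (2 * x)) \<le> x * (ln x - Digamma x)"
    using assms by (intro mult_left_mono ln_minus_Digamma_bounds) auto
  moreover have "x * (1 / (2 * x)) = 1 / 2" using assms by simp
  moreover have "taylor_coeff 1 x = x\<^sup>2 * hurwitz_sum 2 x - x - x * (ln x - Digamma x)"
    unfolding taylor_coeff_def exponent_deriv_1[OF assms]
    by (simp add: power2_eq_square algebra_simps)
  ultimately show ?thesis by linarith
qed

text \<open>The derivative of \<open>g'\<close> is \<open>-2 a\<^sub>2 / x\<^sup>2 \<le> 0\<close>, so \<open>g'\<close> is at least its limit 0 at infinity.\<close>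

lemma taylor_coeff_1_nonneg:
  assumes "x > 0"
  shows "taylor_coeff 1 x \<ge> 0"
proof -
  \<comment> \<open>An explicit bound g'(y) >= -1/y replaces the limit of g'; monotonicity carries
    it back to x.\<close>
  have "- inverse y \<le> exponent_deriv 1 x" if "x \<le> y" for y
  proof -
    have "y * (1 / y + 1 / (2 * y\<^sup>2)) \<le> y * hurwitz_sum 2 y"
      using assms that by (intro mult_left_mono hurwitz_sum_2_ge) auto
    moreover have "y * (1 / y + 1 / (2 * y\<^sup>2)) \<ge> 1"
      using assms that by (simp add: field_simps)
    ultimately have "- inverse y \<le> exponent_deriv 1 y"
      using exponent_deriv_1[of y] ln_minus_Digamma_bounds(2)[of y] assms that
      unfolding inverse_eq_divide by linarith
    also have "\<dots> \<le> exponent_deriv 1 x"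
    proof (rule DERIV_nonpos_imp_nonincreasing[OF that])
      fix z assume "x \<le> z" "z \<le> y"
      hence z: "z > 0" using assms by simp
      have "exponent_deriv 2 z \<le> 0"
        using exponent_deriv_eq[OF z, of 2] taylor_coeff_nonneg_ge_2[OF z, of 2] z by simp
      thus "\<exists>d. (exponent_deriv 1 has_real_derivative d) (at z) \<and> d \<le> 0"
        using has_field_derivative_exponent_deriv[OF z, of 1] by (auto simp: numeral_2_eq_2)
    qed
    finally show ?thesis .
  qed
  hence "\<forall>\<^sub>F y in at_top. - inverse y \<le> exponent_deriv 1 x"
    by (rule eventually_mono[OF eventually_ge_at_top[of x]])
  moreover have "((\<lambda>y::real. - inverse y) \<longlongrightarrow> - 0) at_top"
    by (intro tendsto_minus tendsto_inverse_0_at_top filterlim_ident)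
  ultimately have "exponent_deriv 1 x \<ge> 0"
    using tendsto_upperbound[of "\<lambda>y. - inverse y" 0 at_top] by simp
  thus ?thesis using assms by (simp add: taylor_coeff_def)
qed

subsection \<open>Higher derivatives\<close>

lemma leibniz_has_field_derivative:
  fixes F G :: "nat \<Rightarrow> real \<Rightarrow> real"
  assumes F: "\<And>k. (F k has_real_derivative F (Suc k) x) (at x)"
    and G: "\<And>k. (G k has_real_derivative G (Suc k) x) (at x)"
  shows "((\<lambda>y. \<Sum>k\<le>n. real (n choose k) * (F k y * G (n - k) y)) has_real_derivative
          (\<Sum>k\<le>Suc n. real (Suc n choose k) * (F k x * G (Suc n - k) x))) (at x)"
proof -
  have "((\<lambda>y. \<Sum>k\<le>n. real (n choose k) * (F k y * G (n - k) y)) has_real_derivative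
     (\<Sum>k\<le>n. real (n choose k) * (F (Suc k) x * G (n - k) x + G (Suc (n - k)) x * F k x))) (at x)"
    by (intro DERIV_sum DERIV_cmult DERIV_mult F G)
  moreover have "(\<Sum>k\<le>n. real (n choose k) * (F (Suc k) x * G (n - k) x + G (Suc (n - k)) x * F k x))
      = (\<Sum>k\<le>Suc n. real (Suc n choose k) * (F k x * G (Suc n - k) x))"
  proof -
    \<comment> \<open>The range may be extended because \<open>n choose Suc n\<close> is 0; shifting
      the index then makes Pascal's rule applicable.\<close>
    have "(\<Sum>k\<le>n. real (n choose k) * (G (Suc (n - k)) x * F k x))
        = (\<Sum>k\<le>Suc n. real (n choose k) * (F k x * G (Suc n - k) x))"
      by (simp add: Suc_diff_le mult.commute)
    also have "\<dots> = F 0 x * G (Suc n) x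
        + (\<Sum>k\<le>n. real (n choose Suc k) * (F (Suc k) x * G (n - k) x))"
      by (subst sum.atMost_Suc_shift) simp
    finally show ?thesis
      by (subst sum.atMost_Suc_shift)
         (simp add: distrib_left distrib_right sum.distrib)
  qed
  ultimately show ?thesis by (simp only:)
qed

section \<open>From explicit derivatives to iterates of \<open>deriv\<close>\<close>

lemma higher_deriv_eqI:
  fixes F :: "nat \<Rightarrow> real \<Rightarrow> real"
  assumes "open S" "\<And>k x. x \<in> S \<Longrightarrow> (F k has_real_derivative F (Suc k) x) (at x)"
    and "\<And>x. x \<in> S \<Longrightarrow> f x = F 0 x" and "x \<in> S"
  shows "(deriv ^^ n) f x = F n x"
  using \<open>x \<in> S\<close>
proof (induction n arbitrary: x)
  case (Suc n)
  have "((deriv ^^ n) f has_real_derivative F (Suc n) x) (at x)"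
    using assms(2)[OF Suc.prems, of n] assms(1) Suc.prems
    by (rule has_field_derivative_transform_within_open) (simp add: Suc.IH)
  thus ?case by (simp add: DERIV_imp_deriv)
qed (use assms in simp)

text \<open>Existential witnesses for the derivatives give closure under sums, products and
  \<open>exp\<close> without formulas for higher derivatives of a composition.\<close>

fun times_diff_on :: "nat \<Rightarrow> real set \<Rightarrow> (real \<Rightarrow> real) \<Rightarrow> bool" where
  "times_diff_on 0 S f \<longleftrightarrow> True"
| "times_diff_on (Suc n) S f \<longleftrightarrow>
     (\<exists>f'. (\<forall>x\<in>S. (f has_real_derivative f' x) (at x)) \<and> times_diff_on n S f')"

lemma times_diff_on_SucD: "times_diff_on (Suc n) S f \<Longrightarrow> times_diff_on n S f"
proof (induction n arbitrary: f)
  case (Suc n)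
  then obtain f' where "\<forall>x\<in>S. (f has_real_derivative f' x) (at x)" "times_diff_on (Suc n) S f'"
    by (auto simp only: times_diff_on.simps(2)[of "Suc n"])
  thus ?case using Suc.IH by auto
qed simp

lemma times_diff_on_add:
  "times_diff_on n S f \<Longrightarrow> times_diff_on n S g \<Longrightarrow> times_diff_on n S (\<lambda>x. f x + g x)"
proof (induction n arbitrary: f g)
  case (Suc n)
  then obtain f' g' where d: "\<forall>x\<in>S. (f has_real_derivative f' x) (at x)" "times_diff_on n S f'"
    "\<forall>x\<in>S. (g has_real_derivative g' x) (at x)" "times_diff_on n S g'"
    by auto
  show ?case
    using d Suc.IH by (auto intro!: exI[of _ "\<lambda>x. f' x + g' x"] DERIV_add)
qed simp

lemma times_diff_on_mult:
  "times_diff_on n S f \<Longrightarrow> times_diff_on n S g \<Longrightarrow> times_diff_on n S (\<lambda>x. f x * g x)"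
proof (induction n arbitrary: f g)
  case (Suc n)
  then obtain f' g' where d: "\<forall>x\<in>S. (f has_real_derivative f' x) (at x)" "times_diff_on n S f'"
    "\<forall>x\<in>S. (g has_real_derivative g' x) (at x)" "times_diff_on n S g'"
    by auto
  have "times_diff_on n S f" "times_diff_on n S g"
    using Suc.prems times_diff_on_SucD by auto
  hence "times_diff_on n S (\<lambda>x. f' x * g x + g' x * f x)"
    using d by (intro times_diff_on_add Suc.IH) auto
  thus ?case
    using d by (auto intro!: exI[of _ "\<lambda>x. f' x * g x + g' x * f x"] DERIV_mult)
qed simp

lemma times_diff_on_exp:
  "times_diff_on n S h \<Longrightarrow> times_diff_on n S (\<lambda>x. exp (h x))"
proof (induction n)
  case (Suc n)
  then obtain h' where d: "\<forall>x\<in>S. (h has_real_derivative h' x) (at x)" "times_diff_on n S h'"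
    by auto
  have "times_diff_on n S h"
    using Suc.prems times_diff_on_SucD by auto
  hence "times_diff_on n S (\<lambda>x. exp (h x) * h' x)"
    using d Suc.IH by (intro times_diff_on_mult) auto
  thus ?case
    using d by (auto intro!: exI[of _ "\<lambda>x. exp (h x) * h' x"] derivative_eq_intros)
qed simp

lemma times_diff_on_sequence:
  assumes "\<And>k x. x \<in> S \<Longrightarrow> (F k has_real_derivative F (Suc k) x) (at x)"
  shows "times_diff_on n S (F k)"
proof (induction n arbitrary: k)
  case (Suc n)
  thus ?case using assms by (auto intro!: exI[of _ "F (Suc k)"])
qed simp

text \<open>A separate g is needed for the induction: \<open>deriv g\<close> agrees with the witness
  derivative only on S.\<close>

lemma times_diff_on_imp_higher_deriv_differentiable:
  assumes "open S" "x \<in> S"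
  shows "times_diff_on (Suc n) S f \<Longrightarrow> (\<And>y. y \<in> S \<Longrightarrow> g y = f y) \<Longrightarrow>
           (deriv ^^ n) g differentiable (at x)"
proof (induction n arbitrary: f g)
  case 0
  then obtain f' where "\<forall>x\<in>S. (f has_real_derivative f' x) (at x)" by auto
  hence "(g has_real_derivative f' x) (at x)"
    using 0 assms has_field_derivative_transform_within_open[of f "f' x" x S g] by auto
  thus ?case by (auto simp: real_differentiable_def)
next
  case (Suc n)
  then obtain f' where f': "\<forall>x\<in>S. (f has_real_derivative f' x) (at x)" "times_diff_on (Suc n) S f'"
    by (auto simp only: times_diff_on.simps(2)[of "Suc n"])
  have "deriv g y = f' y" if "y \<in> S" for y
    using that f' Suc.prems assms has_field_derivative_transform_within_open[of f "f' y" y S g]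
    by (auto intro!: DERIV_imp_deriv)
  hence "(deriv ^^ n) (deriv g) differentiable (at x)"
    using Suc.IH f' by blast
  thus ?case by (simp add: funpow_swap1)
qed

subsection \<open>Sign of the derivatives of the logarithm\<close>

text \<open>Leibniz' sum for (g - \<alpha>) ln x; the constant enters only the undifferentiated
  factor.\<close>

definition log_power_deriv :: "real \<Rightarrow> nat \<Rightarrow> real \<Rightarrow> real" where
  "log_power_deriv \<alpha> n x = (\<Sum>k\<le>n. real (n choose k) *
     ((exponent_deriv k x - (if k = 0 then \<alpha> else 0)) * ln_deriv (n - k) x))"

lemma has_field_derivative_log_power_deriv:
  assumes "x > 0"
  shows "(log_power_deriv \<alpha> n has_real_derivative log_power_deriv \<alpha> (Suc n) x) (at x)"
proof -
  let ?F = "\<lambda>k x. exponent_deriv k x - (if k = 0 then \<alpha> else 0)"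
  have "(?F k has_real_derivative ?F (Suc k) x) (at x)" for k
    using DERIV_diff[OF has_field_derivative_exponent_deriv[OF assms] DERIV_const] by simp
  thus ?thesis
    unfolding log_power_deriv_def [abs_def]
    by (rule leibniz_has_field_derivative[of ?F x ln_deriv n,
          OF _ has_field_derivative_ln_deriv[OF assms]])
qed

lemma log_power_deriv_eq:
  assumes "x > 0" "n \<ge> 1"
  shows "(- 1) ^ n * log_power_deriv \<alpha> n x = fact n / x ^ n *
     ((\<alpha> - exponent_deriv 0 x) / real n + (\<Sum>k=1..<n. taylor_coeff k x / real (n - k))
        - taylor_coeff n x * ln x)"
proof -
  let ?t = "\<lambda>k. real (n choose k) *
     ((exponent_deriv k x - (if k = 0 then \<alpha> else 0)) * ln_deriv (n - k) x)"
  have ln_deriv: "ln_deriv j x = (- 1) ^ Suc j * fact j / real j / x ^ j" if j: "j \<ge> 1" for j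
  proof -
    obtain i where i: "j = Suc i" using j by (cases j) auto
    have "fact j / real j = (fact i :: real)" by (simp add: i)
    thus ?thesis unfolding i by simp
  qed
  \<comment> \<open>The end terms are special: k = 0 carries \<alpha>, and k = n carries the
    logarithm itself.\<close>
  have "{..n} = insert 0 (insert n {1..<n})" using assms by auto
  hence "log_power_deriv \<alpha> n x = ?t 0 + ?t n + (\<Sum>k=1..<n. ?t k)"
    using assms by (simp add: log_power_deriv_def)
  hence "(- 1) ^ n * log_power_deriv \<alpha> n x
      = (- 1) ^ n * ?t 0 + (- 1) ^ n * ?t n + (\<Sum>k=1..<n. (- 1) ^ n * ?t k)"
    by (simp add: distrib_left sum_distrib_left)
  also have "(- 1) ^ n * ?t 0 = fact n / x ^ n * ((\<alpha> - exponent_deriv 0 x) / real n)"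
    using assms by (simp add: ln_deriv field_simps)
  also have "(- 1) ^ n * ?t n = fact n / x ^ n * (- taylor_coeff n x * ln x)"
    using assms exponent_deriv_eq[OF assms(1), of n] by simp
  also have "(\<Sum>k=1..<n. (- 1) ^ n * ?t k) = (\<Sum>k=1..<n. fact n / x ^ n * (taylor_coeff k x / real (n - k)))"
  proof (rule sum.cong [OF refl])
    fix k assume k: "k \<in> {1..<n}"
    define j where "j = n - k"
    have n: "n = k + j" and j: "j \<ge> 1" and k1: "k \<ge> 1" using k by (auto simp: j_def)
    have choose: "real (n choose k) * fact k * fact j = fact n"
      using k by (simp add: binomial_fact j_def)
    have sign: "(- 1) ^ n * (- 1) ^ Suc k * (- 1) ^ Suc j = (1 :: real)"
      by (cases "even k"; cases "even j") (simp_all add: n)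
    have "(- 1) ^ n * ?t k = (- 1) ^ n * (real (n choose k) *
        ((- 1) ^ Suc k * fact k / x ^ k * taylor_coeff k x * ((- 1) ^ Suc j * fact j / real j / x ^ j)))"
      using k1 exponent_deriv_eq[OF assms(1), of k] ln_deriv[OF j]
      unfolding j_def [symmetric] by (simp del: power_Suc)
    also have "\<dots> = ((- 1) ^ n * (- 1) ^ Suc k * (- 1) ^ Suc j) * (real (n choose k) * fact k * fact j)
        / (x ^ k * x ^ j) * (taylor_coeff k x / real j)"
      by (simp add: mult_ac del: power_Suc)
    also have "\<dots> = fact n / x ^ n * (taylor_coeff k x / real (n - k))"
      unfolding sign choose by (simp add: n power_add)
    finally show "(- 1) ^ n * ?t k = fact n / x ^ n * (taylor_coeff k x / real (n - k))" .
  qed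
  finally show ?thesis
    by (simp add: sum_distrib_left algebra_simps)
qed

text \<open>The factor 1/2 is just enough for both uses: it gives 1/4 for n = 1 and 1/(8(n-1)) <=
  1/(4n) for n >= 2.\<close>

lemma ln_le_half:
  fixes s :: real
  assumes "s > 0"
  shows "ln s \<le> s / 2"
proof -
  have "ln (s / 2) \<le> s / 2 - 1" using assms by (intro ln_le_minus_one) auto
  moreover have "ln (s / 2) = ln s - ln 2" using assms by (simp add: ln_div)
  moreover have "ln (2::real) \<le> 2 - 1" by (intro ln_le_minus_one) auto
  ultimately show ?thesis by simp
qed

lemma log_power_deriv_sign:
  assumes "x > 0" "n \<ge> 1" "\<alpha> \<ge> - 1 / 4"
  shows "(- 1) ^ n * log_power_deriv \<alpha> n x \<ge> 0"
proof -
  have "x * (1 / (2 * x)) \<le> x * (ln x - Digamma x)"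
    using assms by (intro mult_left_mono ln_minus_Digamma_bounds) auto
  moreover have "x * (1 / (2 * x)) = 1 / 2" using assms by simp
  ultimately have E: "\<alpha> - exponent_deriv 0 x \<ge> 1 / 4"
    using assms(3) unfolding exponent_deriv_0 right_diff_distrib by linarith
  have "taylor_coeff n x * ln x
        \<le> 1 / (4 * real n) + (\<Sum>k=1..<n. taylor_coeff k x / real (n - k))"
  proof (cases "n = 1")
    case True
    have "taylor_coeff 1 x * ln x \<le> taylor_coeff 1 x * (x / 2)"
      using assms taylor_coeff_1_nonneg ln_le_half by (intro mult_left_mono) auto
    also have "\<dots> \<le> 1 / (2 * x) * (x / 2)"
      using assms taylor_coeff_1_le by (intro mult_right_mono) auto
    finally show ?thesis using True assms by simp
  next
    case False
    hence n: "n \<ge> 2" using assms by simp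
    define m where "m = n - 2"
    have nm: "n = m + 2" using n by (simp add: m_def)
    have an: "0 \<le> taylor_coeff n x" "taylor_coeff n x \<le> 1 / (4 * x)"
      using taylor_coeff_nonneg_ge_2[OF assms(1) n] taylor_coeff_antimono[OF assms(1) _ n]
        taylor_coeff_2_le[OF assms(1)] by auto
    have "taylor_coeff n x * ln (x / (real m + 1)) \<le> taylor_coeff n x * (x / (real m + 1) / 2)"
      using an assms by (intro mult_left_mono ln_le_half) auto
    also have "\<dots> \<le> 1 / (4 * x) * (x / (real m + 1) / 2)"
      using an assms by (intro mult_right_mono) auto
    also have "\<dots> \<le> 1 / (4 * real n)"
      using assms by (simp add: nm field_simps)
    finally have 1: "taylor_coeff n x * ln (x / (real m + 1)) \<le> 1 / (4 * real n)" .
    \<comment> \<open>With m = n - 2, the substitution of n - k for k turns the harmonic sum into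
      denominators n - k for k = 2, ..., n-1, where the coefficients dominate the n-th one.\<close>
    have "taylor_coeff n x * ln (real m + 1) \<le> taylor_coeff n x * harm m"
      using an ln_le_harm by (intro mult_left_mono) auto
    also have "\<dots> = (\<Sum>k=2..<n. taylor_coeff n x / real (n - k))"
      unfolding harm_def sum_distrib_left
      by (rule sum.reindex_bij_witness[of _ "\<lambda>k. n - k" "\<lambda>k. n - k"])
         (auto simp: nm divide_inverse)
    also have "\<dots> \<le> (\<Sum>k=2..<n. taylor_coeff k x / real (n - k))"
      using assms by (intro sum_mono divide_right_mono taylor_coeff_antimono) auto
    also have "\<dots> \<le> (\<Sum>k=1..<n. taylor_coeff k x / real (n - k))"
    \<comment> \<open>The coefficient at k = 1 lies outside the monotone range, so only its sign is
      used.\<close>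
    proof -
      have "{1..<n} = insert 1 {2..<n}" using n by auto
      thus ?thesis using taylor_coeff_1_nonneg[OF assms(1)] by simp
    qed
    finally have "taylor_coeff n x * ln (real m + 1)
        \<le> (\<Sum>k=1..<n. taylor_coeff k x / real (n - k))" .
    moreover have "taylor_coeff n x * ln x
        = taylor_coeff n x * ln (x / (real m + 1)) + taylor_coeff n x * ln (real m + 1)"
      using assms by (simp add: ln_div algebra_simps)
    ultimately show ?thesis using 1 by linarith
  qed
  moreover have "1 / (4 * real n) \<le> (\<alpha> - exponent_deriv 0 x) / real n"
    using divide_right_mono[OF E, of "real n"] by simp
  ultimately show ?thesis
    unfolding log_power_deriv_eq[OF assms(1,2)] using assms(1)
    by (intro mult_nonneg_nonneg) auto
qed

theorem proposition1p8:
  fixes \<alpha> :: real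
  assumes "\<alpha> \<ge> -1/4"
  shows "log_completely_monotonic_on
           (\<lambda>x. x powr (x * (Digamma x - ln x) - \<alpha>)) {0<..}"
proof -
  let ?f = "\<lambda>x. x powr (x * (Digamma x - ln x) - \<alpha>)"
  have F: "(log_power_deriv \<alpha> k has_real_derivative log_power_deriv \<alpha> (Suc k) x) (at x)"
    if "x \<in> {0<..}" for k x
    using that by (intro has_field_derivative_log_power_deriv) simp
  have f: "?f x = exp (log_power_deriv \<alpha> 0 x)" if "x \<in> {0<..}" for x
    using that by (simp add: powr_def log_power_deriv_def exponent_deriv_0)
  have smooth: "(deriv ^^ n) ?f differentiable (at x)" if "x \<in> {0<..}" for n x
    by (rule times_diff_on_imp_higher_deriv_differentiable
          [OF open_greaterThan that times_diff_on_exp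
            [OF times_diff_on_sequence [of _ "log_power_deriv \<alpha>", OF F]] f])
  have "(deriv ^^ n) (\<lambda>t. ln (?f t)) x = log_power_deriv \<alpha> n x" if "x \<in> {0<..}" for n x
    by (rule higher_deriv_eqI [of _ "log_power_deriv \<alpha>", OF open_greaterThan F _ that]) (simp_all add: f)
  moreover have "(- 1) ^ n * log_power_deriv \<alpha> n x \<ge> 0" if "n \<ge> 1" "x \<in> {0<..}" for n x
    using log_power_deriv_sign [of x n \<alpha>] that assms by simp
  ultimately show ?thesis
    unfolding log_completely_monotonic_on_def
    using smooth by (auto simp: is_interval_def)
qed

end
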